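(* If $\mathcal{C}$ is a finite permutation class, then the class of permutations that can be generated by the $\mathcal{C}$-machine has a rational generating function $\sum_{n} a_n x^n$, where $a_n$ is the number of permutations of length $n$ that can be generated.
   Context: A permutation class is a set of permutations closed downward under pattern containment (where $\pi$ contains $\sigma$ if $\pi$ has a subsequence order isomorphic to $\sigma$). For a permutation class $\mathcal{C}$, the $\mathcal{C}$-machine has an input, initially $1,2,\dots,n$, a container, initially empty, holding a sequence of distinct integers, and an output, initially empty. The allowed operations are: (bypass) remove the next input entry and append it to the end of the output; (push) remove the next input entry and insert it at some position in the container, provided the container's contents remain order isomorphic to a permutation in $\mathcal{C}$; (pop) remove the leftmost container entry and append it to the end of the output. A permutation $\pi$ of length $n$ can be generated by the $\mathcal{C}$-machine if some sequence of operations starting from input $1,\dots,n$ ends with empty input and empty container and output $\pi$. *)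

theory Defs
  imports
    "HOL-Library.Sublist"
    "HOL-Combinatorics.Multiset_Permutations"
    "HOL-Computational_Algebra.Polynomial_FPS"
begin

text \<open>Permutations are written in one-line notation, as lists over \<open>{1..n}\<close>;
  the empty permutation is allowed.\<close>

definition is_perm :: "nat list \<Rightarrow> bool" where
  "is_perm \<pi> \<longleftrightarrow> \<pi> \<in> permutations_of_set {1..length \<pi>}"

definition order_iso :: "nat list \<Rightarrow> nat list \<Rightarrow> bool" where
  "order_iso xs ys \<longleftrightarrow> length xs = length ys \<and>
     (\<forall>i < length xs. \<forall>j < length xs. xs ! i < xs ! j \<longleftrightarrow> ys ! i < ys ! j)"

definition contains_pattern :: "nat list \<Rightarrow> nat list \<Rightarrow> bool" where
  "contains_pattern \<pi> \<sigma> \<longleftrightarrow> (\<exists>ys. subseq ys \<pi> \<and> order_iso ys \<sigma>)"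

definition perm_class :: "nat list set \<Rightarrow> bool" where
  "perm_class C \<longleftrightarrow> (\<forall>\<pi>\<in>C. is_perm \<pi>) \<and>
     (\<forall>\<pi>\<in>C. \<forall>\<sigma>. is_perm \<sigma> \<and> contains_pattern \<pi> \<sigma> \<longrightarrow> \<sigma> \<in> C)"

text \<open>A state consists of the input, the container and the output, each read from left to right.\<close>

type_synonym machine_state = "nat list \<times> nat list \<times> nat list"

inductive machine_step :: "nat list set \<Rightarrow> machine_state \<Rightarrow> machine_state \<Rightarrow> bool"
  for C :: "nat list set" where
  bypass: "machine_step C (x # inp, c, out) (inp, c, out @ [x])"
| push: "\<exists>\<sigma>\<in>C. order_iso (u @ [x] @ v) \<sigma> \<Longrightarrow>
     machine_step C (x # inp, u @ v, out) (inp, u @ [x] @ v, out)"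
| pop: "machine_step C (inp, y # c, out) (inp, c, out @ [y])"

definition machine_generated :: "nat list set \<Rightarrow> nat list set" where
  "machine_generated C = {\<pi>. is_perm \<pi> \<and>
     (machine_step C)\<^sup>*\<^sup>* ([1..<Suc (length \<pi>)], [], []) ([], [], \<pi>)}"

definition perm_gf :: "nat list set \<Rightarrow> rat fps" where
  "perm_gf A = Abs_fps (\<lambda>n. of_nat (card {\<pi> \<in> A. length \<pi> = n}))"

text \<open>A power series that is a quotient of two polynomials can always be written with a
  denominator whose constant term is nonzero; only then is it invertible as a power series.\<close>

definition rational_fps :: "'a::field fps \<Rightarrow> bool" where
  "rational_fps F \<longleftrightarrow>
     (\<exists>p q. coeff q 0 \<noteq> 0 \<and> F = fps_of_poly p / fps_of_poly q)"

end

theory Submission imports Defs begin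

text \<open>A permutation is determined by its Lehmer code, and the Lehmer entry of an output entry is
  visible inside the machine: every input entry exceeds the container, so a popped entry contributes
  its rank in the container and a bypassed entry contributes the size of the container. Hence the
  codes of the generated permutations form the language of a nondeterministic automaton whose states
  are the order types of containers, the pushes being silent moves. For finite \<open>C\<close> this automaton
  is finite, so the language has finitely many residuals, and their generating functions solve a
  linear system over the rational power series.\<close>

unbundle fps_syntax

section \<open>Rational power series\<close>

text \<open>A nonzero constant term makes \<open>fps_of_poly q\<close> a unit, so the fraction can
  be cleared; the closure proofs then only multiply.\<close>

lemma rational_fps_iff:
  "rational_fps (F :: 'a::field fps) \<longleftrightarrow>
     (\<exists>p q. coeff q 0 \<noteq> 0 \<and> F * fps_of_poly q = fps_of_poly p)"
proof -
  have "F = fps_of_poly p / fps_of_poly q \<longleftrightarrow> F * fps_of_poly q = fps_of_poly p"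
    if "coeff q 0 \<noteq> 0" for p q :: "'a poly"
  proof -
    have q: "fps_of_poly q $ 0 \<noteq> 0" using that by simp
    have inv: "inverse (fps_of_poly q) * fps_of_poly q = 1"
      by (rule inverse_mult_eq_1[OF q])
    show ?thesis
    proof
      assume "F = fps_of_poly p / fps_of_poly q"
      then have "F * fps_of_poly q = fps_of_poly p * (inverse (fps_of_poly q) * fps_of_poly q)"
        by (simp add: fps_divide_unit[OF q] mult.assoc)
      then show "F * fps_of_poly q = fps_of_poly p" by (simp add: inv)
    next
      assume "F * fps_of_poly q = fps_of_poly p"
      then have "fps_of_poly p / fps_of_poly q = F * (inverse (fps_of_poly q) * fps_of_poly q)"
        by (simp add: fps_divide_unit[OF q] mult.assoc mult.commute)
      then show "F = fps_of_poly p / fps_of_poly q" by (simp add: inv)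
    qed
  qed
  then show ?thesis unfolding rational_fps_def by blast
qed

lemma rational_fps_of_poly: "rational_fps (fps_of_poly p :: 'a::field fps)"
  unfolding rational_fps_iff by (rule exI[of _ p], rule exI[of _ 1]) simp

lemma rational_fps_add:
  fixes F G :: "'a::field fps"
  assumes "rational_fps F" "rational_fps G"
  shows "rational_fps (F + G)"
proof -
  from assms obtain p q p' q' where q: "coeff q 0 \<noteq> 0" "F * fps_of_poly q = fps_of_poly p"
    and q': "coeff q' 0 \<noteq> 0" "G * fps_of_poly q' = fps_of_poly p'"
    unfolding rational_fps_iff by blast
  have "(F + G) * fps_of_poly (q * q') =
      (F * fps_of_poly q) * fps_of_poly q' + (G * fps_of_poly q') * fps_of_poly q"
    by (simp add: fps_of_poly_mult algebra_simps)
  also have "\<dots> = fps_of_poly (p * q' + p' * q)"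
    by (simp add: q q' fps_of_poly_mult fps_of_poly_add)
  finally show ?thesis
    unfolding rational_fps_iff using q q' by (metis coeff_mult_0 mult_eq_0_iff)
qed

lemma rational_fps_mult:
  fixes F G :: "'a::field fps"
  assumes "rational_fps F" "rational_fps G"
  shows "rational_fps (F * G)"
proof -
  from assms obtain p q p' q' where q: "coeff q 0 \<noteq> 0" "F * fps_of_poly q = fps_of_poly p"
    and q': "coeff q' 0 \<noteq> 0" "G * fps_of_poly q' = fps_of_poly p'"
    unfolding rational_fps_iff by blast
  have "(F * G) * fps_of_poly (q * q') = (F * fps_of_poly q) * (G * fps_of_poly q')"
    by (simp add: fps_of_poly_mult algebra_simps)
  also have "\<dots> = fps_of_poly (p * p')"
    by (simp add: q q' fps_of_poly_mult)
  finally show ?thesis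
    unfolding rational_fps_iff using q q' by (metis coeff_mult_0 mult_eq_0_iff)
qed

text \<open>Numerator and denominator swap roles: the constant term of \<open>p\<close> is the
  product of those of \<open>F\<close> and \<open>q\<close>, hence nonzero.\<close>

lemma rational_fps_inverse:
  fixes F :: "'a::field fps"
  assumes "rational_fps F" "F $ 0 \<noteq> 0"
  shows "rational_fps (inverse F)"
proof -
  from assms obtain p q where q: "coeff q 0 \<noteq> 0" "F * fps_of_poly q = fps_of_poly p"
    unfolding rational_fps_iff by blast
  have "coeff p 0 = F $ 0 * coeff q 0"
    using arg_cong[OF q(2), of "\<lambda>F. F $ 0"] by simp
  then have "coeff p 0 \<noteq> 0" using q assms by simp
  moreover have "inverse F * fps_of_poly p = (inverse F * F) * fps_of_poly q"
    by (simp add: q(2)[symmetric] mult.assoc)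
  ultimately show ?thesis
    unfolding rational_fps_iff using inverse_mult_eq_1[OF assms(2)] by auto
qed

lemma rational_fps_sum:
  fixes F :: "'b \<Rightarrow> 'a::field fps"
  assumes "\<And>i. i \<in> I \<Longrightarrow> rational_fps (F i)"
  shows "rational_fps (\<Sum>i\<in>I. F i)"
proof -
  have "rational_fps (0 :: 'a fps)" using rational_fps_of_poly[of 0] by simp
  then show ?thesis using assms
    by (induction I rule: infinite_finite_induct) (auto intro: rational_fps_add)
qed

text \<open>Gaussian elimination: the pivot \<open>1 - m k k\<close> is a unit because \<open>m k k\<close> has no constant term.\<close>

lemma rational_fps_linear_system:
  fixes F :: "'i \<Rightarrow> 'a::field fps"
  assumes "finite I"
    and "\<And>i. i \<in> I \<Longrightarrow> rational_fps (b i)"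
    and "\<And>i j. i \<in> I \<Longrightarrow> j \<in> I \<Longrightarrow> rational_fps (m i j) \<and> m i j $ 0 = 0"
    and "\<And>i. i \<in> I \<Longrightarrow> F i = b i + (\<Sum>j\<in>I. m i j * F j)"
    and "i \<in> I"
  shows "rational_fps (F i)"
  using assms
proof (induction I arbitrary: b m i rule: finite_induct)
  case empty
  then show ?case by simp
next
  case (insert k I)
  note b = insert.prems(1) and m = insert.prems(2) and F = insert.prems(3)
  define r where "r = inverse (1 - m k k)"
  have unit: "(1 - m k k) $ 0 \<noteq> 0" using m[of k k] by simp
  \<comment> \<open>The subtraction is written with a factor -1, so that closure under sums and
    products covers it.\<close>
  have "rational_fps (1 + fps_of_poly [:-1:] * m k k)"
    using m[of k k] rational_fps_of_poly[of "1 :: 'a poly"]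
    by (intro rational_fps_add rational_fps_mult rational_fps_of_poly) auto
  then have "rational_fps (1 - m k k)"
    by (simp add: fps_of_poly_pCons fps_const_neg[symmetric] del: fps_const_neg)
  then have r: "rational_fps r"
    unfolding r_def using unit by (rule rational_fps_inverse)
  have Fk: "F k = r * (b k + (\<Sum>j\<in>I. m k j * F j))"
  proof -
    have "F k = b k + (m k k * F k + (\<Sum>j\<in>I. m k j * F j))"
      using F[of k] insert.hyps by simp
    then have "(1 - m k k) * F k = b k + (\<Sum>j\<in>I. m k j * F j)"
      by (simp add: algebra_simps)
    then have "r * (b k + (\<Sum>j\<in>I. m k j * F j)) = (r * (1 - m k k)) * F k"
      by (simp add: mult.assoc)
    also have "\<dots> = F k" unfolding r_def using inverse_mult_eq_1[OF unit] by simp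
    finally show ?thesis ..
  qed
  \<comment> \<open>Substituting the solved equation for \<open>F k\<close> into the others leaves a
    system over \<open>I\<close>; its coefficients keep constant term 0, since \<open>m i j\<close>
    and \<open>m i k\<close> have it.\<close>
  have I: "rational_fps (F i)" if "i \<in> I" for i
  proof (rule insert.IH[where b = "\<lambda>i. b i + m i k * r * b k"
        and m = "\<lambda>i j. m i j + m i k * r * m k j"])
    fix i assume i: "i \<in> I"
    show "rational_fps (b i + m i k * r * b k)"
      using i r b m by (intro rational_fps_add rational_fps_mult) auto
    have "F i = b i + (m i k * F k + (\<Sum>j\<in>I. m i j * F j))"
      using F[of i] i insert.hyps by simp
    also have "\<dots> = b i + m i k * r * b k + (\<Sum>j\<in>I. (m i j + m i k * r * m k j) * F j)"
      by (subst Fk) (simp add: algebra_simps sum.distrib sum_distrib_left)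
    finally show "F i = \<dots>" .
    fix j assume j: "j \<in> I"
    show "rational_fps (m i j + m i k * r * m k j) \<and> (m i j + m i k * r * m k j) $ 0 = 0"
      using i j r m by (auto intro!: rational_fps_add rational_fps_mult)
  qed (use that in auto)
  moreover have "rational_fps (F k)"
    using I r b m by (subst Fk) (intro rational_fps_mult rational_fps_add rational_fps_sum, auto)
  ultimately show ?case using insert.prems(4) by auto
qed

section \<open>Languages with finitely many residuals\<close>

definition language_gf :: "'l list set \<Rightarrow> 'a::field_char_0 fps" where
  "language_gf L = Abs_fps (\<lambda>n. of_nat (card {w \<in> L. length w = n}))"

definition residual :: "'l \<Rightarrow> 'l list set \<Rightarrow> 'l list set" where
  "residual a L = {w. a # w \<in> L}"

text \<open>A nonempty word is a first letter followed by a word of the corresponding residual. The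
  finite alphabet makes each length class finite, so that \<open>card\<close> adds up over the
  disjoint union.\<close>

lemma language_gf_residuals:
  assumes "finite \<Sigma>" "L \<subseteq> lists \<Sigma>"
  shows "(language_gf L :: 'a::field_char_0 fps) = fps_const (if [] \<in> L then 1 else 0)
           + fps_X * (\<Sum>a\<in>\<Sigma>. language_gf (residual a L))"
proof (rule fps_ext)
  fix n
  show "language_gf L $ n = (fps_const (if [] \<in> L then 1 else 0)
           + fps_X * (\<Sum>a\<in>\<Sigma>. language_gf (residual a L))) $ n"
  proof (cases n)
    case 0
    have "{w \<in> L. length w = 0} = (if [] \<in> L then {[]} else {})" by auto
    then show ?thesis by (simp add: 0 language_gf_def)
  next
    case (Suc k)
    have eq: "{w \<in> L. length w = Suc k} =
        (\<Union>a\<in>\<Sigma>. (#) a ` {w \<in> residual a L. length w = k})"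
    proof (intro equalityI subsetI)
      fix w assume "w \<in> {w \<in> L. length w = Suc k}"
      then obtain a v where w: "w = a # v" "w \<in> L" "length v = k" by (auto simp: length_Suc_conv)
      then have "a \<in> \<Sigma>" using assms(2) by auto
      then show "w \<in> (\<Union>a\<in>\<Sigma>. (#) a ` {w \<in> residual a L. length w = k})"
        using w by (auto simp: residual_def)
    qed (auto simp: residual_def)
    have fin: "finite {w \<in> residual a L. length w = k}" for a
    proof (rule finite_subset)
      show "{w \<in> residual a L. length w = k} \<subseteq> {w. set w \<subseteq> \<Sigma> \<and> length w = k}"
        using assms(2) by (auto simp: residual_def)
    qed (use assms(1) in \<open>rule finite_lists_length_eq\<close>)
    have "card {w \<in> L. length w = Suc k} =
        (\<Sum>a\<in>\<Sigma>. card ((#) a ` {w \<in> residual a L. length w = k}))"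
      unfolding eq by (rule card_UN_disjoint) (use assms(1) fin in auto)
    also have "\<dots> = (\<Sum>a\<in>\<Sigma>. card {w \<in> residual a L. length w = k})"
      by (intro sum.cong refl card_image) auto
    finally show ?thesis
      by (simp add: Suc language_gf_def fps_sum_nth)
  qed
qed

text \<open>The generating functions of the languages in \<open>\<L>\<close> are the unknowns of a
  linear system; each coefficient carries a factor \<open>fps_X\<close> for the letter read, hence
  has no constant term.\<close>

lemma rational_language_gf:
  assumes "finite \<L>" "finite \<Sigma>"
    and "\<And>L. L \<in> \<L> \<Longrightarrow> L \<subseteq> lists \<Sigma>"
    and res: "\<And>L a. L \<in> \<L> \<Longrightarrow> a \<in> \<Sigma> \<Longrightarrow> residual a L \<in> \<L>"
    and "L \<in> \<L>"
  shows "rational_fps (language_gf L :: 'a::field_char_0 fps)"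
proof (rule rational_fps_linear_system[where I = \<L>
      and b = "\<lambda>L. fps_const (if [] \<in> L then 1 else 0)"
      and m = "\<lambda>L M. fps_X * of_nat (card {a \<in> \<Sigma>. residual a L = M})"])
  fix L assume L: "L \<in> \<L>"
  show "rational_fps (fps_const (if [] \<in> L then 1 else 0 :: 'a))"
    using rational_fps_of_poly[of "[:if [] \<in> L then 1 else 0 :: 'a:]"]
    by (simp add: fps_of_poly_const)
  \<comment> \<open>Letters with the same residual are collected, turning the sum over letters into
    a sum over unknowns.\<close>
  have "(\<Sum>a\<in>\<Sigma>. language_gf (residual a L) :: 'a fps) =
      (\<Sum>M\<in>\<L>. \<Sum>a\<in>{a \<in> \<Sigma>. residual a L = M}. language_gf (residual a L))"
    by (rule sum.group[symmetric]) (use assms L in auto)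
  also have "\<dots> = (\<Sum>M\<in>\<L>. of_nat (card {a \<in> \<Sigma>. residual a L = M}) * language_gf M)"
    by (intro sum.cong refl) simp
  finally show "language_gf L = fps_const (if [] \<in> L then 1 else 0 :: 'a) +
      (\<Sum>M\<in>\<L>. fps_X * of_nat (card {a \<in> \<Sigma>. residual a L = M}) * language_gf M)"
    using language_gf_residuals[of \<Sigma> L, where 'a = 'a] assms(2) assms(3)[OF L]
    by (simp only: sum_distrib_left mult.assoc)
  fix M
  show "rational_fps (fps_X * of_nat (card {a \<in> \<Sigma>. residual a L = M}) :: 'a fps) \<and>
      (fps_X * of_nat (card {a \<in> \<Sigma>. residual a L = M}) :: 'a fps) $ 0 = 0"
    using rational_fps_mult[OF rational_fps_of_poly[of "[:0, 1 :: 'a:]"]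
        rational_fps_of_poly[of "[:of_nat (card {a \<in> \<Sigma>. residual a L = M}) :: 'a:]"]]
    by (simp add: fps_of_poly_pCons fps_of_nat)
qed (use assms in auto)

section \<open>Order isomorphism\<close>

text \<open>With pairs in place of indices, dropping or inserting an entry only shrinks or enlarges
  the set of pairs.\<close>

lemma order_iso_zip:
  "order_iso xs ys \<longleftrightarrow> length xs = length ys \<and>
     (\<forall>(x, y) \<in> set (zip xs ys). \<forall>(x', y') \<in> set (zip xs ys). x < x' \<longleftrightarrow> y < y')"
proof (cases "length xs = length ys")
  case True
  then have "set (zip xs ys) = (\<lambda>i. (xs ! i, ys ! i)) ` {..<length xs}"
    by (auto simp: set_zip)
  then show ?thesis using True by (auto simp: order_iso_def)
qed (simp add: order_iso_def)

lemma order_iso_refl: "order_iso xs xs"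
  by (simp add: order_iso_def)

lemma order_iso_sym: "order_iso xs ys \<Longrightarrow> order_iso ys xs"
  by (simp add: order_iso_def)

lemma order_iso_trans: "order_iso xs ys \<Longrightarrow> order_iso ys zs \<Longrightarrow> order_iso xs zs"
  unfolding order_iso_def by metis

lemma order_iso_length: "order_iso xs ys \<Longrightarrow> length xs = length ys"
  by (simp add: order_iso_def)

lemma order_iso_tl: "order_iso (x # xs) (y # ys) \<Longrightarrow> order_iso xs ys"
  unfolding order_iso_zip by auto

lemma order_iso_filter_less:
  assumes "order_iso (x # xs) (y # ys)"
  shows "length (filter (\<lambda>z. z < x) xs) = length (filter (\<lambda>z. z < y) ys)"
proof -
  have "length xs = length ys" "\<forall>(z, z') \<in> set (zip xs ys). z < x \<longleftrightarrow> z' < y"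
    using assms unfolding order_iso_zip by auto
  then show ?thesis by (induction rule: list_induct2) auto
qed

lemma order_iso_insert_max:
  assumes "order_iso (u @ v) (u' @ v')" "length u = length u'"
    and "\<forall>y\<in>set (u @ v). y < x" "\<forall>y\<in>set (u' @ v'). y < x'"
  shows "order_iso (u @ [x] @ v) (u' @ [x'] @ v')"
proof -
  have zip: "set (zip (u @ [x] @ v) (u' @ [x'] @ v')) = insert (x, x') (set (zip (u @ v) (u' @ v')))"
    using assms(2) by simp
  have "y < x \<and> y' < x'" if "(y, y') \<in> set (zip (u @ v) (u' @ v'))" for y y'
    using that assms(3,4) set_zip_leftD set_zip_rightD by metis
  then show ?thesis
    using assms(1,2) unfolding order_iso_zip zip by (fastforce dest: order.asym)
qed

text \<open>Standardization: every entry is replaced by its rank, and ranking with \<le> makes the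
  ranks start at 1, as \<open>is_perm\<close> demands.\<close>

lemma ex_perm_order_iso:
  fixes xs :: "nat list"
  assumes "distinct xs"
  shows "\<exists>\<sigma>. is_perm \<sigma> \<and> order_iso xs \<sigma>"
proof (intro exI conjI)
  define f where "f x = card {y \<in> set xs. y \<le> x}" for x
  have less: "f x < f y" if "x < y" "y \<in> set xs" for x y
    unfolding f_def
  proof (rule psubset_card_mono)
    have "y \<in> {z \<in> set xs. z \<le> y}" "y \<notin> {z \<in> set xs. z \<le> x}" using that by auto
    moreover have "{z \<in> set xs. z \<le> x} \<subseteq> {z \<in> set xs. z \<le> y}" using that by auto
    ultimately show "{z \<in> set xs. z \<le> x} \<subset> {z \<in> set xs. z \<le> y}" by blast
  qed auto
  have le: "f x \<le> f y" if "x \<le> y" for x y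
    unfolding f_def by (rule card_mono) (use that in auto)
  have iff: "f x < f y \<longleftrightarrow> x < y" if "y \<in> set xs" for x y
    using less[OF _ that] le[of y x] by (meson linorder_not_less)
  have inj: "inj_on f (set xs)"
    by (rule inj_onI) (metis iff less_irrefl nat_neq_iff)
  have "f x \<in> {1..length xs}" if "x \<in> set xs" for x
  proof -
    have "card {x} \<le> f x" unfolding f_def by (rule card_mono) (use that in auto)
    moreover have "f x \<le> card (set xs)" unfolding f_def by (rule card_mono) auto
    ultimately show ?thesis using card_length[of xs] by auto
  qed
  then have "f ` set xs = {1..length xs}"
    by (intro card_subset_eq) (auto simp: card_image[OF inj] distinct_card[OF assms])
  then show "is_perm (map f xs)"
    using assms inj by (simp add: is_perm_def permutations_of_set_def distinct_map)
  show "order_iso xs (map f xs)"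
    by (simp add: order_iso_def iff)
qed

section \<open>Lehmer codes\<close>

fun lehmer :: "nat list \<Rightarrow> nat list" where
  "lehmer [] = []"
| "lehmer (x # xs) = length (filter (\<lambda>y. y < x) xs) # lehmer xs"

lemma length_lehmer [simp]: "length (lehmer xs) = length xs"
  by (induction xs) auto

lemma length_filter_mset: "length (filter P xs) = size (filter_mset P (mset xs))"
  by (metis mset_filter size_mset)

lemma length_filter_mset_union:
  assumes "mset xs = mset ys + mset zs"
  shows "length (filter P xs) = length (filter P ys) + length (filter P zs)"
  by (simp add: length_filter_mset assms)

text \<open>Within the common multiset the rank is strictly increasing on members, so the first code
  letter determines the head; the tails follow by induction.\<close>

lemma lehmer_inj:
  assumes "mset xs = mset ys" "lehmer xs = lehmer ys"
  shows "xs = ys"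
  using assms
proof (induction xs arbitrary: ys)
  case Nil
  then show ?case by simp
next
  case (Cons x xs)
  then obtain y ys' where ys: "ys = y # ys'" by (cases ys) auto
  have rank: "size {#z \<in># mset (x # xs). z < x#} = size {#z \<in># mset ys. z < y#}"
    using Cons.prems(2) by (simp add: ys length_filter_mset)
  have less: "size {#z \<in># M. z < a#} < size {#z \<in># M. z < b#}"
    if "a < b" "a \<in># M" for a b :: nat and M
  proof (rule mset_subset_size)
    have "{#z \<in># M. z < a#} \<subseteq># {#z \<in># M. z < b#}"
      using that(1) by (intro mset_subset_eqI) auto
    moreover have "a \<in># {#z \<in># M. z < b#}" "a \<notin># {#z \<in># M. z < a#}" using that by auto
    ultimately show "{#z \<in># M. z < a#} \<subset># {#z \<in># M. z < b#}"
      by (metis subset_mset.le_imp_less_or_eq)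
  qed
  have "x \<in># mset ys" "y \<in># mset ys"
    using Cons.prems(1) by (metis list.set_intros(1) set_mset_mset, simp add: ys)
  then have "x = y"
    using less[of x y "mset ys"] less[of y x "mset ys"] rank Cons.prems(1)
    by (metis less_irrefl nat_neq_iff)
  then show ?case using Cons ys by auto
qed

section \<open>The machine as a nondeterministic automaton\<close>

text \<open>\<open>machine_word C c w\<close> says that, starting with container \<open>c\<close>, the machine can empty itself
  in such a way that the output has Lehmer code \<open>w\<close>. Input entries exceed all container entries, so
  the code of an output entry can be read off the container; the actual value of a pushed entry is
  irrelevant, so any new maximum is allowed.\<close>

inductive machine_word :: "nat list set \<Rightarrow> nat list \<Rightarrow> nat list \<Rightarrow> bool"
  for C :: "nat list set" where
  finish: "machine_word C [] []"
| bypass: "machine_word C c w \<Longrightarrow> machine_word C c (length c # w)"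
| push: "\<lbrakk>\<forall>y\<in>set (u @ v). y < x; \<exists>\<sigma>\<in>C. order_iso (u @ [x] @ v) \<sigma>;
     machine_word C (u @ [x] @ v) w\<rbrakk> \<Longrightarrow> machine_word C (u @ v) w"
| pop: "machine_word C c w \<Longrightarrow>
     machine_word C (y # c) (length (filter (\<lambda>z. z < y) c) # w)"

section \<open>Length bound and invariance under order isomorphism\<close>

text \<open>Every container entry still has to be popped, and each pop emits a letter. The bound
  later guarantees a nonempty input when a push or bypass is replayed.\<close>

lemma machine_word_length: "machine_word C c w \<Longrightarrow> length c \<le> length w"
  by (induction rule: machine_word.induct) auto

lemma ex_strict_upper_bound: "\<exists>x. \<forall>y\<in>set (ys :: nat list). y < x"
  using finite_nat_set_iff_bounded by auto

lemma order_iso_appendE: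
  assumes "order_iso (u @ v) d"
  obtains u' v' where "d = u' @ v'" "length u = length u'"
proof
  show "d = take (length u) d @ drop (length u) d" by simp
  show "length u = length (take (length u) d)" using order_iso_length[OF assms] by simp
qed

text \<open>Letters record only sizes and ranks, and inserting a maximum at the same place preserves
  order isomorphism. Hence members of \<open>insert [] C\<close> suffice as states.\<close>

lemma machine_word_order_iso:
  "machine_word C c w \<Longrightarrow> order_iso c d \<Longrightarrow> machine_word C d w"
proof (induction arbitrary: d rule: machine_word.induct)
  case finish
  then have "d = []" using order_iso_length by fastforce
  then show ?case by (simp add: machine_word.finish)
next
  case (bypass c w)
  then show ?case using machine_word.bypass[of C d w] order_iso_length[of c d] by simp
next
  case (push u v x w)
  obtain u' v' where d: "d = u' @ v'" and len: "length u = length u'"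
    using order_iso_appendE[OF push.prems] .
  \<comment> \<open>The two containers need not receive the same new entry; any strict upper bound
    of \<open>d\<close> serves.\<close>
  obtain x' where x': "\<forall>y\<in>set (u' @ v'). y < x'" using ex_strict_upper_bound by blast
  have iso: "order_iso (u @ [x] @ v) (u' @ [x'] @ v')"
    using push.prems push.hyps(1) x' len unfolding d by (intro order_iso_insert_max)
  have "\<exists>\<sigma>\<in>C. order_iso (u' @ [x'] @ v') \<sigma>"
    using push.hyps(2) iso order_iso_sym order_iso_trans by blast
  then show ?case unfolding d using push.IH[OF iso] by (rule machine_word.push[OF x'])
next
  case (pop c w y)
  obtain y' c' where d: "d = y' # c'"
    using order_iso_length[OF pop.prems(1)] by (cases d) auto
  have iso: "order_iso (y # c) (y' # c')" using pop.prems d by simp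
  show ?case
    unfolding d order_iso_filter_less[OF iso]
    by (rule machine_word.pop[OF pop.IH[OF order_iso_tl[OF iso]]])
qed

section \<open>Correspondence between runs and code words\<close>

text \<open>Induction from the first step of the run. The multiset clause splits each code letter
  into a count over the container and one over the input: no input entry lies below a popped entry,
  and a bypassed entry has exactly the container below it.\<close>

lemma machine_steps_imp_word:
  assumes "(machine_step C)\<^sup>*\<^sup>* s ([], [], \<pi>)"
  shows "s = (inp, c, out) \<Longrightarrow> sorted_wrt (<) inp \<Longrightarrow> \<forall>y\<in>set c. \<forall>x\<in>set inp. y < x \<Longrightarrow>
    \<exists>w. \<pi> = out @ w \<and> mset w = mset c + mset inp \<and> machine_word C c (lehmer w)"
  using assms
proof (induction arbitrary: inp c out rule: converse_rtranclp_induct)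
  case base
  then show ?case by (auto intro: machine_word.finish)
next
  case (step s t)
  from step.hyps(1) show ?case
  proof cases
    case (bypass x inp' c' out')
    then have s: "inp = x # inp'" "c' = c" "out' = out" using step.prems by auto
    have "\<exists>w. \<pi> = (out @ [x]) @ w \<and> mset w = mset c + mset inp' \<and> machine_word C c (lehmer w)"
      by (rule step.IH) (use bypass step.prems s in auto)
    then obtain w where w: "\<pi> = (out @ [x]) @ w" "mset w = mset c + mset inp'"
      "machine_word C c (lehmer w)" by blast
    have "filter (\<lambda>y. y < x) c = c" "filter (\<lambda>y. y < x) inp' = []"
      using step.prems s by (auto simp: filter_empty_conv filter_id_conv dest: order.asym)
    then have "length (filter (\<lambda>y. y < x) w) = length c"
      using length_filter_mset_union[OF w(2)] by simp
    then show ?thesis using w machine_word.bypass[OF w(3)] s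
      by (intro exI[of _ "x # w"]) auto
  next
    case (push u x v inp' out')
    then have s: "inp = x # inp'" "c = u @ v" "out' = out" using step.prems by auto
    have "\<exists>w. \<pi> = out @ w \<and> mset w = mset (u @ [x] @ v) + mset inp' \<and>
        machine_word C (u @ [x] @ v) (lehmer w)"
      by (rule step.IH) (use push step.prems s in auto)
    then obtain w where w: "\<pi> = out @ w" "mset w = mset (u @ [x] @ v) + mset inp'"
      "machine_word C (u @ [x] @ v) (lehmer w)" by blast
    have "machine_word C (u @ v) (lehmer w)"
      by (rule machine_word.push[OF _ push(3) w(3)]) (use step.prems s in auto)
    then show ?thesis using w s by auto
  next
    case (pop inp' y c' out')
    then have s: "inp' = inp" "c = y # c'" "out' = out" using step.prems by auto
    have "\<exists>w. \<pi> = (out @ [y]) @ w \<and> mset w = mset c' + mset inp \<and> machine_word C c' (lehmer w)"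
      by (rule step.IH) (use pop step.prems s in auto)
    then obtain w where w: "\<pi> = (out @ [y]) @ w" "mset w = mset c' + mset inp"
      "machine_word C c' (lehmer w)" by blast
    have "filter (\<lambda>z. z < y) inp = []"
      using step.prems s by (auto simp: filter_empty_conv dest: order.asym)
    then have "length (filter (\<lambda>z. z < y) w) = length (filter (\<lambda>z. z < y) c')"
      using length_filter_mset_union[OF w(2)] by simp
    then show ?thesis using w machine_word.pop[OF w(3), of y] s
      by (intro exI[of _ "y # w"]) auto
  qed
qed

text \<open>The word may be derived with arbitrary new maxima, while the machine pushes actual input
  entries; hence the induction carries a container \<open>d\<close> order isomorphic to
  \<open>c\<close>. The length equation forces the input to be used up exactly.\<close>

lemma machine_word_imp_steps:
  assumes "machine_word C c w" "order_iso c d"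
    and "sorted_wrt (<) inp" "\<forall>y\<in>set d. \<forall>x\<in>set inp. y < x" "length d + length inp = length w"
  shows "\<exists>\<pi>. (machine_step C)\<^sup>*\<^sup>* (inp, d, out) ([], [], out @ \<pi>) \<and> lehmer \<pi> = w"
  using assms
proof (induction arbitrary: d inp out rule: machine_word.induct)
  case finish
  then show ?case by (intro exI[of _ "[]"]) (auto simp: order_iso_def)
next
  case (bypass c w)
  then have len: "length d \<le> length w"
    using machine_word_length order_iso_length by metis
  then obtain x inp' where inp: "inp = x # inp'" using bypass.prems by (cases inp) auto
  obtain \<pi> where \<pi>: "(machine_step C)\<^sup>*\<^sup>* (inp', d, out @ [x]) ([], [], (out @ [x]) @ \<pi>)"
    "lehmer \<pi> = w"
    using bypass.IH[of d inp' "out @ [x]"] bypass.prems inp by auto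
  have steps: "(machine_step C)\<^sup>*\<^sup>* (inp, d, out) ([], [], out @ x # \<pi>)"
    using converse_rtranclp_into_rtranclp[OF machine_step.bypass \<pi>(1)] inp by simp
  \<comment> \<open>The converse direction, applied to the run just assembled, identifies the
    entries still to be output.\<close>
  have mset: "mset \<pi> = mset d + mset inp'"
    using inp machine_steps_imp_word[OF steps refl bypass.prems(2,3)] by auto
  have "filter (\<lambda>y. y < x) d = d" "filter (\<lambda>y. y < x) inp' = []"
    using bypass.prems inp by (auto simp: filter_empty_conv filter_id_conv dest: order.asym)
  then have "length (filter (\<lambda>y. y < x) \<pi>) = length d"
    using length_filter_mset_union[OF mset] by simp
  then show ?case using steps \<pi>(2) order_iso_length[OF bypass.prems(1)]
    by (intro exI[of _ "x # \<pi>"]) simp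
next
  case (push u v x w)
  obtain u' v' where d: "d = u' @ v'" and len: "length u = length u'"
    using order_iso_appendE[OF push.prems(1)] .
  have "length (u @ [x] @ v) \<le> length w" using push.hyps(3) by (rule machine_word_length)
  then have "length d < length w" using order_iso_length[OF push.prems(1)] by simp
  then obtain x' inp' where inp: "inp = x' # inp'" using push.prems by (cases inp) auto
  have iso: "order_iso (u @ [x] @ v) (u' @ [x'] @ v')"
    using push.prems push.hyps(1) len unfolding d inp by (intro order_iso_insert_max) auto
  have C: "\<exists>\<sigma>\<in>C. order_iso (u' @ [x'] @ v') \<sigma>"
    using push.hyps(2) iso order_iso_sym order_iso_trans by blast
  have "\<exists>\<pi>. (machine_step C)\<^sup>*\<^sup>* (inp', u' @ [x'] @ v', out) ([], [], out @ \<pi>) \<and> lehmer \<pi> = w"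
    by (rule push.IH[OF iso]) (use push.prems in \<open>auto simp: d inp\<close>)
  then show ?case unfolding d inp
    using converse_rtranclp_into_rtranclp[of "machine_step C", OF machine_step.push[OF C]] by blast
next
  case (pop c w y)
  obtain y' c' where d: "d = y' # c'"
    using order_iso_length[OF pop.prems(1)] by (cases d) auto
  obtain \<pi> where \<pi>: "(machine_step C)\<^sup>*\<^sup>* (inp, c', out @ [y']) ([], [], (out @ [y']) @ \<pi>)"
    "lehmer \<pi> = w"
    using pop.IH[of c' inp "out @ [y']"] pop.prems d order_iso_tl by auto
  have steps: "(machine_step C)\<^sup>*\<^sup>* (inp, d, out) ([], [], out @ y' # \<pi>)"
    using converse_rtranclp_into_rtranclp[OF machine_step.pop \<pi>(1)] d by simp
  have mset: "mset \<pi> = mset c' + mset inp"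
    using d machine_steps_imp_word[OF steps refl pop.prems(2,3)] by auto
  have "filter (\<lambda>z. z < y') inp = []"
    using pop.prems d by (auto simp: filter_empty_conv dest: order.asym)
  then have "length (filter (\<lambda>z. z < y') \<pi>) = length (filter (\<lambda>z. z < y') c')"
    using length_filter_mset_union[OF mset] by simp
  then show ?case using steps \<pi>(2) order_iso_filter_less[of y c y' c'] pop.prems(1) d
    by (intro exI[of _ "y' # \<pi>"]) simp
qed

text \<open>Different runs with the same output give the same code, so permutations rather than runs
  are matched with words. Injectivity holds because all outputs of length \<open>n\<close> have the
  same entries.\<close>

lemma card_machine_generated:
  "card {\<pi> \<in> machine_generated C. length \<pi> = n} = card {w. machine_word C [] w \<and> length w = n}"
proof (rule bij_betw_same_card[of lehmer], unfold bij_betw_def, intro conjI)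
  have sorted: "sorted_wrt (<) [1..<Suc n]" by (rule sorted_wrt_upt)
  have perm: "mset \<pi> = mset [1..<Suc n]" if "is_perm \<pi>" "length \<pi> = n" for \<pi>
  proof -
    have "distinct \<pi>" "set \<pi> = set [1..<Suc n]"
      using that unfolding is_perm_def permutations_of_set_def
      by (simp_all add: atLeastLessThanSuc_atLeastAtMost del: upt_Suc)
    then show ?thesis using set_eq_iff_mset_eq_distinct distinct_upt by blast
  qed
  show "inj_on lehmer {\<pi> \<in> machine_generated C. length \<pi> = n}"
  proof (rule inj_onI)
    fix \<pi> \<rho> assume "\<pi> \<in> {\<pi> \<in> machine_generated C. length \<pi> = n}"
      "\<rho> \<in> {\<pi> \<in> machine_generated C. length \<pi> = n}" and eq: "lehmer \<pi> = lehmer \<rho>"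
    then have "mset \<pi> = mset \<rho>" by (simp add: machine_generated_def perm del: upt_Suc)
    then show "\<pi> = \<rho>" using eq by (rule lehmer_inj)
  qed
  show "lehmer ` {\<pi> \<in> machine_generated C. length \<pi> = n} =
      {w. machine_word C [] w \<and> length w = n}"
  proof (intro equalityI subsetI)
    fix w assume "w \<in> lehmer ` {\<pi> \<in> machine_generated C. length \<pi> = n}"
    then obtain \<pi> where \<pi>: "w = lehmer \<pi>" "length \<pi> = n"
      "(machine_step C)\<^sup>*\<^sup>* ([1..<Suc n], [], []) ([], [], \<pi>)"
      by (auto simp: machine_generated_def simp del: upt_Suc)
    then show "w \<in> {w. machine_word C [] w \<and> length w = n}"
      using machine_steps_imp_word[OF \<pi>(3) refl sorted] by simp
  next
    fix w assume "w \<in> {w. machine_word C [] w \<and> length w = n}"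
    then have w: "machine_word C [] w" "length w = n" by auto
    then obtain \<pi> where \<pi>: "(machine_step C)\<^sup>*\<^sup>* ([1..<Suc n], [], []) ([], [], \<pi>)" "lehmer \<pi> = w"
      using machine_word_imp_steps[OF w(1) order_iso_refl sorted, of "[]"] by (auto simp del: upt_Suc)
    have len: "length \<pi> = n" using \<pi>(2) w(2) length_lehmer by metis
    have "mset \<pi> = mset [1..<Suc n]"
      using machine_steps_imp_word[OF \<pi>(1) refl sorted] by (simp del: upt_Suc)
    then have "set \<pi> = {1..n}" "distinct \<pi>"
      by (metis atLeastLessThanSuc_atLeastAtMost mset_eq_setD set_upt,
          metis distinct_upt mset_eq_imp_distinct_iff)
    then show "w \<in> lehmer ` {\<pi> \<in> machine_generated C. length \<pi> = n}"
      using \<pi> len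
      by (intro image_eqI[of _ _ \<pi>])
        (auto simp: machine_generated_def is_perm_def permutations_of_set_def simp del: upt_Suc)
  qed
qed

section \<open>Finitely many residuals for a finite class\<close>

text \<open>\<open>[]\<close> is adjoined because the machine starts with an empty container even if
  \<open>C\<close> is the empty class.\<close>

definition container_ok :: "nat list set \<Rightarrow> nat list \<Rightarrow> bool" where
  "container_ok C c \<longleftrightarrow> (\<exists>\<sigma>\<in>insert [] C. order_iso c \<sigma>)"

text \<open>Downward closure enters here: deleting the first entry of the matching member of
  \<open>C\<close> and standardizing gives a contained pattern, so popping stays within the
  states.\<close>

lemma container_ok_tl:
  assumes "perm_class C" "container_ok C (y # c)"
  shows "container_ok C c"
proof -
  obtain \<sigma> where \<sigma>: "\<sigma> \<in> C" "order_iso (y # c) \<sigma>"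
    using assms(2) order_iso_length unfolding container_ok_def by fastforce
  then obtain r \<rho> where r: "\<sigma> = r # \<rho>" using order_iso_length by (metis length_Suc_conv)
  have "is_perm \<sigma>" using assms(1) \<sigma>(1) unfolding perm_class_def by blast
  then have "distinct \<rho>" unfolding r is_perm_def permutations_of_set_def by simp
  then obtain \<tau> where \<tau>: "is_perm \<tau>" "order_iso \<rho> \<tau>" using ex_perm_order_iso by blast
  have "subseq \<rho> \<sigma>" unfolding r by (simp add: list_emb_Cons)
  then have "\<tau> \<in> C" using assms(1) \<sigma>(1) \<tau> unfolding perm_class_def contains_pattern_def by blast
  then show ?thesis
    using \<sigma>(2) \<tau>(2) order_iso_tl order_iso_trans unfolding r container_ok_def by blast
qed

text \<open>A letter never exceeds the size of the current container, so the alphabet is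
  finite.\<close>

lemma machine_word_letters:
  assumes "machine_word C c w" "container_ok C c" "perm_class C" "\<forall>\<sigma>\<in>C. length \<sigma> \<le> K"
  shows "set w \<subseteq> {..K}"
proof -
  have len: "length c \<le> K" if "container_ok C c" for c
    using that assms(4) order_iso_length unfolding container_ok_def by force
  from assms(1,2) show ?thesis
  proof (induction rule: machine_word.induct)
    case (pop c w y)
    have "length (filter (\<lambda>z. z < y) c) \<le> K"
      using length_filter_le[of _ c] len[OF pop.prems] by (metis le_trans length_Cons Suc_leD)
    then show ?case using pop container_ok_tl[OF assms(3)] by auto
  qed (use len in \<open>auto simp: container_ok_def\<close>)
qed

text \<open>\<open>c'\<close> is the container right after the first letter is emitted; the silent
  pushes before it and the emission can precede any continuation from \<open>c'\<close>.\<close>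

lemma machine_word_first_letter:
  assumes "machine_word C c (a # w)" "container_ok C c" "perm_class C"
  shows "\<exists>c'. container_ok C c' \<and> machine_word C c' w \<and>
           (\<forall>w'. machine_word C c' w' \<longrightarrow> machine_word C c (a # w'))"
  using assms(1,2)
proof (induction c "a # w" rule: machine_word.induct)
  case (bypass c)
  then show ?case using machine_word.bypass by blast
next
  case (push u v x)
  then show ?case using machine_word.push[OF push.hyps(1,2)] unfolding container_ok_def by blast
next
  case (pop c y)
  then show ?case using machine_word.pop container_ok_tl[OF assms(3)] by blast
qed

section \<open>Subset construction and conclusion\<close>

text \<open>Sets of start states are used because, after a letter, the nondeterministic automaton
  may be in any of several states.\<close>

definition machine_language :: "nat list set \<Rightarrow> nat list set \<Rightarrow> nat list set" where
  "machine_language C S = {w. \<exists>c\<in>S. machine_word C c w}"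

lemma residual_machine_language:
  assumes "perm_class C" "S \<subseteq> insert [] C"
  shows "\<exists>T \<subseteq> insert [] C. residual a (machine_language C S) = machine_language C T"
proof (intro exI conjI)
  \<comment> \<open>\<open>?T\<close> is the largest set of states whose languages lie in the
    residual, chosen by inclusion rather than reachability. One inclusion is then immediate; the
    other takes the container after the first letter and replaces it by its order type.\<close>
  let ?T = "{\<tau> \<in> insert [] C. \<forall>w. machine_word C \<tau> w \<longrightarrow> a # w \<in> machine_language C S}"
  show "?T \<subseteq> insert [] C" by blast
  show "residual a (machine_language C S) = machine_language C ?T"
  proof (intro equalityI subsetI)
    fix w assume "w \<in> residual a (machine_language C S)"
    then obtain c where c: "c \<in> S" "machine_word C c (a # w)"
      unfolding residual_def machine_language_def by blast
    have "container_ok C c" using c(1) assms(2) order_iso_refl unfolding container_ok_def by blast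
    then obtain c' where c': "container_ok C c'" "machine_word C c' w"
      "\<forall>w'. machine_word C c' w' \<longrightarrow> machine_word C c (a # w')"
      using machine_word_first_letter[OF c(2) _ assms(1)] by blast
    then obtain \<tau> where \<tau>: "\<tau> \<in> insert [] C" "order_iso c' \<tau>" unfolding container_ok_def by blast
    then have "\<tau> \<in> ?T" "machine_word C \<tau> w"
      using c(1) c' machine_word_order_iso order_iso_sym unfolding machine_language_def by blast+
    then show "w \<in> machine_language C ?T" unfolding machine_language_def by blast
  qed (auto simp: machine_language_def residual_def)
qed

theorem theorem5p1:
  fixes C :: "nat list set"
  assumes "perm_class C" and "finite C"
  shows "rational_fps (perm_gf (machine_generated C))"
proof -
  obtain K where K: "\<forall>\<sigma>\<in>C. length \<sigma> \<le> K"
    using finite_imageI[OF assms(2), of length] by (auto simp: finite_nat_set_iff_bounded_le)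
  \<comment> \<open>The family of languages is indexed by the subsets of the finite set
    \<open>insert [] C\<close>, so it is finite, and it is closed under residuals.\<close>
  have "rational_fps (language_gf (machine_language C {[]}) :: rat fps)"
  proof (rule rational_language_gf[where \<L> = "machine_language C ` Pow (insert [] C)"
        and \<Sigma> = "{..K}"])
    fix L assume "L \<in> machine_language C ` Pow (insert [] C)"
    then obtain S where S: "S \<subseteq> insert [] C" "L = machine_language C S" by blast
    have "container_ok C c" if "c \<in> S" for c
      using that S order_iso_refl unfolding container_ok_def by blast
    then show "L \<subseteq> lists {..K}"
      using machine_word_letters[OF _ _ assms(1) K] S
      unfolding machine_language_def by blast
    show "residual a L \<in> machine_language C ` Pow (insert [] C)" for a
      using residual_machine_language[OF assms(1) S(1)] S(2) by blast
  qed (use assms in auto)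
  moreover have "perm_gf (machine_generated C) = language_gf (machine_language C {[]})"
    unfolding perm_gf_def language_gf_def machine_language_def
    by (simp add: card_machine_generated)
  ultimately show ?thesis by simp
qed

end
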